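(* Let $N,k,\ell$ be positive integers, let $0=X_0<X_1<\dots<X_k=N$ and $0=Y_0<Y_1<\dots<Y_\ell=N$ be integers, and let $I=[I_{uv}]_{1\le u\le k,\,1\le v\le \ell}$ be a convex $0/1$ array. Assume that there exists at least one permutation of $\{1,\dots,N\}$ restricted by $\Omega^{X,Y,I}$. Let $a,b>0$ and $q=b^2/a^2$. Consider the correspondence between configurations $\sigma^{6v}$ of the six-vertex model in the domain $\Omega^{X,Y,I}$ (with the boundary conditions described in the context) with degenerate weights (i.e. without Type 6 vertices) and permutations $\sigma^{\mathrm{perm}}$ restricted by $\Omega^{X,Y,I}$, which identifies the set of positions of the Type 5 vertices of $\sigma^{6v}$ with the set of points $\{(\sigma^{\mathrm{perm}}(m),m)\}_{m=1}^N$. Then this correspondence is a bijection, and it carries the probability measure $$\mathrm{Prob}(\sigma^{6v})=\frac1Z\prod_{i=1}^{5} w_i^{N_i(\sigma^{6v})}$$ with degenerate weights to the probability measure $\mathrm{Prob}(\sigma^{\mathrm{perm}})=\frac{1}{\mathcal Z}q^{\mathrm{inv}(\sigma^{\mathrm{perm}})}$ on permutations restricted by $\Omega^{X,Y,I}$.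
   Context: Convex array: a $k\times\ell$ array $I$ with $0/1$ entries ($u$ is the horizontal coordinate, increasing to the right, and $v$ the vertical coordinate, increasing upwards) is convex if for each $u$ the set $\{v: I_{uv}=1\}$ is a non-empty segment of consecutive integers, and for each $v$ the set $\{u: I_{uv}=1\}$ is a non-empty segment of consecutive integers. Domain: $\Omega^{X,Y,I}=\{(x,y)\in\mathbb Z^2: X_{u-1}<x\le X_u,\ Y_{v-1}<y\le Y_v \text{ for some }(u,v)\text{ with } I_{uv}=1\}\subset\{1,\dots,N\}^2$. Six-vertex model: a configuration in a finite domain $\Omega\subset\mathbb Z^2$ assigns occupied/unoccupied status to every grid edge having at least one endpoint in $\Omega$, so that every vertex of $\Omega$ has one of the following six types (paths go up and to the right, may touch but do not cross): Type 1, no incident edge is occupied; Type 2, all four incident edges are occupied; Type 3, exactly the left and right edges are occupied; Type 4, exactly the bottom and top edges are occupied; Type 5, exactly the left and top edges are occupied; Type 6, exactly the bottom and right edges are occupied. Boundary conditions on $\Omega^{X,Y,I}$ ($I$ convex): among edges joining $\Omega^{X,Y,I}$ to its complement, the occupied ones are exactly the left edge of the left-most vertex of the domain in each of the $N$ rows and the top edge of the upper-most vertex of the domain in each of the $N$ columns. $N_i(\sigma)$ is the number of vertices of Type $i$. The degenerate weights are $(w_1,\dots,w_6)=(a,a,b,b,1,0)$, so that only configurations without Type 6 vertices are allowed. $Z$ and $\mathcal Z$ are normalization constants. A permutation $\sigma$ of $\{1,\dots,N\}$ is restricted by $\Omega^{X,Y,I}$ if $(\sigma(m),m)\in\Omega^{X,Y,I}$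 for every $m=1,\dots,N$. Its number of inversions is $\mathrm{inv}(\sigma)=\#\{i<j:\sigma(i)>\sigma(j)\}$. *)

theory Defs
  imports "HOL-Probability.Probability" "HOL-Combinatorics.Permutations"
begin

subsection \<open>Domains\<close>

type_synonym point = "int \<times> int"

text \<open>The first index of an array is horizontal, the second one vertical, and indices start at 1.
  Only the entries with indices in the given ranges matter.\<close>

definition convex_array :: "nat \<Rightarrow> nat \<Rightarrow> (nat \<Rightarrow> nat \<Rightarrow> nat) \<Rightarrow> bool" where
  "convex_array k l I \<longleftrightarrow>
     (\<forall>u\<in>{1..k}. \<forall>v\<in>{1..l}. I u v \<in> {0, 1}) \<and>
     (\<forall>u\<in>{1..k}. \<exists>c d. c \<le> d \<and> {v \<in> {1..l}. I u v = 1} = {c..d}) \<and>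
     (\<forall>v\<in>{1..l}. \<exists>c d. c \<le> d \<and> {u \<in> {1..k}. I u v = 1} = {c..d})"

definition grid_partition :: "int \<Rightarrow> nat \<Rightarrow> (nat \<Rightarrow> int) \<Rightarrow> bool" where
  "grid_partition N k X \<longleftrightarrow> X 0 = 0 \<and> X k = N \<and> (\<forall>u\<in>{1..k}. X (u - 1) < X u)"

definition array_domain ::
  "nat \<Rightarrow> nat \<Rightarrow> (nat \<Rightarrow> int) \<Rightarrow> (nat \<Rightarrow> int) \<Rightarrow> (nat \<Rightarrow> nat \<Rightarrow> nat) \<Rightarrow> point set" where
  "array_domain k l X Y I =
     {(x, y). \<exists>u\<in>{1..k}. \<exists>v\<in>{1..l}.
        I u v = 1 \<and> X (u - 1) < x \<and> x \<le> X u \<and> Y (v - 1) < y \<and> y \<le> Y v}"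

subsection \<open>The six-vertex model\<close>

text \<open>Edges are undirected, so an edge is the set of its two endpoints. A configuration is
  the set of its occupied edges.\<close>

type_synonym edge = "point set"

fun left_edge right_edge bottom_edge top_edge :: "point \<Rightarrow> edge" where
  "left_edge (x, y) = {(x - 1, y), (x, y)}"
| "right_edge (x, y) = {(x, y), (x + 1, y)}"
| "bottom_edge (x, y) = {(x, y - 1), (x, y)}"
| "top_edge (x, y) = {(x, y), (x, y + 1)}"

definition incident_edges :: "point \<Rightarrow> edge set" where
  "incident_edges p = {left_edge p, right_edge p, bottom_edge p, top_edge p}"

definition domain_edges :: "point set \<Rightarrow> edge set" where
  "domain_edges \<Omega> = (\<Union>p\<in>\<Omega>. incident_edges p)"

definition boundary_edges :: "point set \<Rightarrow> edge set" where
  "boundary_edges \<Omega> = {e \<in> domain_edges \<Omega>. \<not> e \<subseteq> \<Omega>}"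

text \<open>The occupied edges at a vertex of Type \<open>i\<close>; meaningful for \<open>i \<in> {1..6}\<close> only.\<close>

definition type_edges :: "nat \<Rightarrow> point \<Rightarrow> edge set" where
  "type_edges i p =
     [{},
      {left_edge p, right_edge p, bottom_edge p, top_edge p},
      {left_edge p, right_edge p},
      {bottom_edge p, top_edge p},
      {left_edge p, top_edge p},
      {bottom_edge p, right_edge p}] ! (i - 1)"

definition has_type :: "edge set \<Rightarrow> point \<Rightarrow> nat \<Rightarrow> bool" where
  "has_type s p i \<longleftrightarrow> s \<inter> incident_edges p = type_edges i p"

definition vertices_of_type :: "point set \<Rightarrow> nat \<Rightarrow> edge set \<Rightarrow> point set" where
  "vertices_of_type \<Omega> i s = {p \<in> \<Omega>. has_type s p i}"

definition leftmost :: "point set \<Rightarrow> point set" where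
  "leftmost \<Omega> = {(x, y) \<in> \<Omega>. \<forall>x'. (x', y) \<in> \<Omega> \<longrightarrow> x \<le> x'}"

definition uppermost :: "point set \<Rightarrow> point set" where
  "uppermost \<Omega> = {(x, y) \<in> \<Omega>. \<forall>y'. (x, y') \<in> \<Omega> \<longrightarrow> y' \<le> y}"

definition six_vertex_configs :: "point set \<Rightarrow> edge set set" where
  "six_vertex_configs \<Omega> =
     {s. s \<subseteq> domain_edges \<Omega> \<and>
         (\<forall>p\<in>\<Omega>. \<exists>i\<in>{1..6}. has_type s p i) \<and>
         s \<inter> boundary_edges \<Omega> = left_edge ` leftmost \<Omega> \<union> top_edge ` uppermost \<Omega>}"

definition degenerate_configs :: "point set \<Rightarrow> edge set set" where
  "degenerate_configs \<Omega> = {s \<in> six_vertex_configs \<Omega>. vertices_of_type \<Omega> 6 s = {}}"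

definition degenerate_weight :: "real \<Rightarrow> real \<Rightarrow> nat \<Rightarrow> real" where
  "degenerate_weight a b i = [a, a, b, b, 1, 0] ! (i - 1)"

definition config_weight :: "point set \<Rightarrow> real \<Rightarrow> real \<Rightarrow> edge set \<Rightarrow> real" where
  "config_weight \<Omega> a b s =
     (\<Prod>i=1..5. degenerate_weight a b i ^ card (vertices_of_type \<Omega> i s))"

subsection \<open>Restricted permutations\<close>

definition restricted_perms :: "int \<Rightarrow> point set \<Rightarrow> (int \<Rightarrow> int) set" where
  "restricted_perms N \<Omega> = {\<sigma>. \<sigma> permutes {1..N} \<and> (\<forall>m\<in>{1..N}. (\<sigma> m, m) \<in> \<Omega>)}"

definition inversions :: "int \<Rightarrow> (int \<Rightarrow> int) \<Rightarrow> nat" where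
  "inversions N \<sigma> = card {(i, j). i \<in> {1..N} \<and> j \<in> {1..N} \<and> i < j \<and> \<sigma> i > \<sigma> j}"

definition perm_points :: "int \<Rightarrow> (int \<Rightarrow> int) \<Rightarrow> point set" where
  "perm_points N \<sigma> = {(\<sigma> m, m) | m. m \<in> {1..N}}"

subsection \<open>Measures with prescribed weights\<close>

text \<open>The measure on the finite set \<open>A\<close> whose point masses are proportional to \<open>w\<close>.\<close>

definition normalized_measure :: "'a set \<Rightarrow> ('a \<Rightarrow> real) \<Rightarrow> 'a measure" where
  "normalized_measure A w = point_measure A (\<lambda>x. ennreal (w x / (\<Sum>y\<in>A. w y)))"

end

theory Submission
  imports Defs
begin

text \<open>
  At a vertex that is not of Type 6, either the path arriving from the left leaves to the right and
  the path arriving from below leaves upwards, or the vertex is of Type 5. So along a row the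
  horizontal edges are occupied up to one vertex and unoccupied after it, and along a column the
  vertical edges are unoccupied up to one vertex and occupied after it; both switches happen at
  Type 5 vertices. The boundary conditions force exactly one switch in each row and in each column.
  Hence the Type 5 vertices form a permutation matrix inside the domain, and the configuration is
  recovered from it (\<open>config_of_perm_surj\<close>): a ray of occupied edges runs to the left and another one
  upwards from each point of the permutation. Conversely, these rays form an admissible
  configuration for each restricted permutation (\<open>config_of_perm_degenerate\<close>).

  The type of a vertex of the configuration of \<open>\<sigma>\<close> is determined by the position of \<open>(x, y)\<close>
  relative to the permutation point of its row and to the one of its column. It has Type 3 or 4
  exactly when these two points form an inversion of \<open>\<sigma>\<close>. Over the full square every inversion
  is seen by two vertices. For a vertex of the square outside the domain, the side on which the
  segments of the domain in its row and in its column lie is fixed, and so are the sides on which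
  the permutation points lie; therefore the number of inversions seen from outside the domain is
  the same for all restricted permutations (\<open>crossed_points_outside\<close>). Thus the number of vertices
  of Types 3 and 4 is \<open>2 inv(\<sigma>)\<close> minus a constant, and the weight is a constant multiple of
  \<open>q ^ inv(\<sigma>)\<close> (\<open>config_weight_eq\<close>).
\<close>

section \<open>Edges and vertex types\<close>

text \<open>Every edge of the lattice has a unique name as a left edge or as a top edge of a vertex;
  rewriting to these names reduces equality of edges to equality of points.\<close>

lemma right_edge_conv_left_edge: "right_edge (x, y) = left_edge (x + 1, y)"
  by simp

lemma bottom_edge_conv_top_edge: "bottom_edge (x, y) = top_edge (x, y - 1)"
  by simp

lemma left_edge_eq_iff: "left_edge p = left_edge p' \<longleftrightarrow> p = p'"
  by (cases p; cases p') (auto simp: doubleton_eq_iff)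

lemma top_edge_eq_iff: "top_edge p = top_edge p' \<longleftrightarrow> p = p'"
  by (cases p; cases p') (auto simp: doubleton_eq_iff)

lemma left_edge_neq_top_edge: "left_edge p \<noteq> top_edge p'" "top_edge p' \<noteq> left_edge p"
  by (cases p; cases p'; auto simp: doubleton_eq_iff)+

lemmas edge_names = right_edge_conv_left_edge bottom_edge_conv_top_edge

lemmas edge_eq_simps = left_edge_eq_iff top_edge_eq_iff left_edge_neq_top_edge

text \<open>The definition of an edge as a set of two points is needed only for the facts above and for
  incidence with the domain.\<close>

declare left_edge.simps [simp del] right_edge.simps [simp del]
  bottom_edge.simps [simp del] top_edge.simps [simp del]

lemma Int_eq_iff_ball: "T \<subseteq> E \<Longrightarrow> s \<inter> E = T \<longleftrightarrow> (\<forall>e\<in>E. e \<in> s \<longleftrightarrow> e \<in> T)"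
  by blast

lemma subset_eq_iff_ball: "A \<subseteq> C \<Longrightarrow> B \<subseteq> C \<Longrightarrow> A = B \<longleftrightarrow> (\<forall>x\<in>C. x \<in> A \<longleftrightarrow> x \<in> B)"
  by blast

lemma has_type_iff:
  "has_type s (x, y) 1 \<longleftrightarrow> left_edge (x, y) \<notin> s \<and> left_edge (x + 1, y) \<notin> s \<and>
      top_edge (x, y - 1) \<notin> s \<and> top_edge (x, y) \<notin> s"
  "has_type s (x, y) 2 \<longleftrightarrow> left_edge (x, y) \<in> s \<and> left_edge (x + 1, y) \<in> s \<and>
      top_edge (x, y - 1) \<in> s \<and> top_edge (x, y) \<in> s"
  "has_type s (x, y) 3 \<longleftrightarrow> left_edge (x, y) \<in> s \<and> left_edge (x + 1, y) \<in> s \<and>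
      top_edge (x, y - 1) \<notin> s \<and> top_edge (x, y) \<notin> s"
  "has_type s (x, y) 4 \<longleftrightarrow> left_edge (x, y) \<notin> s \<and> left_edge (x + 1, y) \<notin> s \<and>
      top_edge (x, y - 1) \<in> s \<and> top_edge (x, y) \<in> s"
  "has_type s (x, y) 5 \<longleftrightarrow> left_edge (x, y) \<in> s \<and> left_edge (x + 1, y) \<notin> s \<and>
      top_edge (x, y - 1) \<notin> s \<and> top_edge (x, y) \<in> s"
  "has_type s (x, y) 6 \<longleftrightarrow> left_edge (x, y) \<notin> s \<and> left_edge (x + 1, y) \<in> s \<and>
      top_edge (x, y - 1) \<in> s \<and> top_edge (x, y) \<notin> s"
  unfolding has_type_def incident_edges_def type_edges_def edge_names
  by (simp_all add: Int_eq_iff_ball edge_eq_simps numeral_eq_Suc)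

lemma incident_edges_conv:
  "incident_edges (x, y) =
     {left_edge (x, y), left_edge (x + 1, y), top_edge (x, y - 1), top_edge (x, y)}"
  by (simp add: incident_edges_def edge_names)

lemma ex_type_1_6: "(\<exists>i\<in>{1..6::nat}. P i) \<longleftrightarrow> P 1 \<or> P 2 \<or> P 3 \<or> P 4 \<or> P 5 \<or> P 6"
proof -
  have "{1..6::nat} = {1, 2, 3, 4, 5, 6}" by auto
  then show ?thesis by simp
qed

text \<open>Without Type 6 vertices, the local rule says that straight lines continue except where a
  horizontal line ends and a vertical line starts.\<close>

lemma allowed_vertex_iff:
  "(\<exists>i\<in>{1..6}. has_type s (x, y) i) \<and> \<not> has_type s (x, y) 6 \<longleftrightarrow>
    (left_edge (x, y) \<in> s \<longleftrightarrow> left_edge (x + 1, y) \<in> s) \<and>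
    (top_edge (x, y - 1) \<in> s \<longleftrightarrow> top_edge (x, y) \<in> s) \<or>
    left_edge (x, y) \<in> s \<and> left_edge (x + 1, y) \<notin> s \<and>
    top_edge (x, y - 1) \<notin> s \<and> top_edge (x, y) \<in> s"
  unfolding ex_type_1_6 has_type_iff by blast

lemma edge_set_eqI:
  assumes "s \<subseteq> domain_edges \<Omega>" "t \<subseteq> domain_edges \<Omega>"
    and "\<And>p. p \<in> \<Omega> \<Longrightarrow> s \<inter> incident_edges p = t \<inter> incident_edges p"
  shows "s = t"
  using assms unfolding domain_edges_def by blast

section \<open>Domains whose rows and columns are segments\<close>

locale segmented_domain =
  fixes N :: int and \<Omega> :: "point set"
  assumes inside_square: "\<Omega> \<subseteq> {1..N} \<times> {1..N}"
    and row_segment: "y \<in> {1..N} \<Longrightarrow> \<exists>c d. c \<le> d \<and> (\<forall>x. (x, y) \<in> \<Omega> \<longleftrightarrow> c \<le> x \<and> x \<le> d)"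
    and column_segment: "x \<in> {1..N} \<Longrightarrow> \<exists>c d. c \<le> d \<and> (\<forall>y. (x, y) \<in> \<Omega> \<longleftrightarrow> c \<le> y \<and> y \<le> d)"
begin

lemma row_convex:
  "(x1, y) \<in> \<Omega> \<Longrightarrow> (x2, y) \<in> \<Omega> \<Longrightarrow> x1 \<le> x \<Longrightarrow> x \<le> x2 \<Longrightarrow> (x, y) \<in> \<Omega>"
  using inside_square row_segment[of y] by fastforce

lemma column_convex:
  "(x, y1) \<in> \<Omega> \<Longrightarrow> (x, y2) \<in> \<Omega> \<Longrightarrow> y1 \<le> y \<Longrightarrow> y \<le> y2 \<Longrightarrow> (x, y) \<in> \<Omega>"
  using inside_square column_segment[of x] by fastforce

lemma finite_domain: "finite \<Omega>"
  using inside_square by (rule finite_subset) simp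

lemma leftmost_iff: "(x, y) \<in> leftmost \<Omega> \<longleftrightarrow> (x, y) \<in> \<Omega> \<and> (x - 1, y) \<notin> \<Omega>"
proof -
  have "x \<le> x'" if "(x, y) \<in> \<Omega>" "(x - 1, y) \<notin> \<Omega>" "(x', y) \<in> \<Omega>" for x'
    using row_convex[of x' y x "x - 1"] that by fastforce
  then show ?thesis by (force simp: leftmost_def)
qed

lemma uppermost_iff: "(x, y) \<in> uppermost \<Omega> \<longleftrightarrow> (x, y) \<in> \<Omega> \<and> (x, y + 1) \<notin> \<Omega>"
proof -
  have "y' \<le> y" if "(x, y) \<in> \<Omega>" "(x, y + 1) \<notin> \<Omega>" "(x, y') \<in> \<Omega>" for y'
    using column_convex[of x y y' "y + 1"] that by fastforce
  then show ?thesis by (force simp: uppermost_def)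
qed

lemma left_edge_in_domain_edges:
  "left_edge (x, y) \<in> domain_edges \<Omega> \<longleftrightarrow> (x, y) \<in> \<Omega> \<or> (x - 1, y) \<in> \<Omega>"
proof
  assume "left_edge (x, y) \<in> domain_edges \<Omega>"
  then show "(x, y) \<in> \<Omega> \<or> (x - 1, y) \<in> \<Omega>"
    by (auto simp: domain_edges_def incident_edges_conv edge_eq_simps)
next
  assume "(x, y) \<in> \<Omega> \<or> (x - 1, y) \<in> \<Omega>"
  moreover have "left_edge (x, y) \<in> incident_edges (x, y)"
    "left_edge (x, y) \<in> incident_edges (x - 1, y)"
    by (simp_all add: incident_edges_conv)
  ultimately show "left_edge (x, y) \<in> domain_edges \<Omega>"
    unfolding domain_edges_def by blast
qed

lemma top_edge_in_domain_edges:
  "top_edge (x, y) \<in> domain_edges \<Omega> \<longleftrightarrow> (x, y) \<in> \<Omega> \<or> (x, y + 1) \<in> \<Omega>"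
proof
  assume "top_edge (x, y) \<in> domain_edges \<Omega>"
  then show "(x, y) \<in> \<Omega> \<or> (x, y + 1) \<in> \<Omega>"
    by (auto simp: domain_edges_def incident_edges_conv edge_eq_simps)
next
  assume "(x, y) \<in> \<Omega> \<or> (x, y + 1) \<in> \<Omega>"
  moreover have "top_edge (x, y) \<in> incident_edges (x, y)"
    "top_edge (x, y) \<in> incident_edges (x, y + 1)"
    by (simp_all add: incident_edges_conv)
  ultimately show "top_edge (x, y) \<in> domain_edges \<Omega>"
    unfolding domain_edges_def by blast
qed

lemma left_edge_in_boundary_edges:
  "left_edge (x, y) \<in> boundary_edges \<Omega> \<longleftrightarrow> ((x, y) \<in> \<Omega> \<longleftrightarrow> (x - 1, y) \<notin> \<Omega>)"
  by (auto simp: boundary_edges_def left_edge_in_domain_edges) (auto simp: left_edge.simps)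

lemma top_edge_in_boundary_edges:
  "top_edge (x, y) \<in> boundary_edges \<Omega> \<longleftrightarrow> ((x, y) \<in> \<Omega> \<longleftrightarrow> (x, y + 1) \<notin> \<Omega>)"
  by (auto simp: boundary_edges_def top_edge_in_domain_edges) (auto simp: top_edge.simps)

lemma edge_cases:
  assumes "e \<in> domain_edges \<Omega>"
  obtains x y where "e = left_edge (x, y)" | x y where "e = top_edge (x, y)"
proof -
  obtain x y where "e \<in> incident_edges (x, y)"
    using assms by (auto simp: domain_edges_def)
  then show thesis
    unfolding incident_edges_conv using that by blast
qed

text \<open>A boundary edge has exactly one endpoint in the domain. Written as the left edge of \<open>(x, y)\<close>,
  it bounds its row from the left if that endpoint is \<open>(x, y)\<close>, and must be occupied; otherwise it
  bounds its row from the right, and must be vacant. Because rows are segments, the first case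
  occurs only at leftmost vertices. Columns are similar, with occupied edges at the top.\<close>

lemma boundary_condition_iff:
  assumes "s \<subseteq> domain_edges \<Omega>"
  shows "s \<inter> boundary_edges \<Omega> = left_edge ` leftmost \<Omega> \<union> top_edge ` uppermost \<Omega> \<longleftrightarrow>
    (\<forall>x y. ((x, y) \<in> \<Omega> \<longleftrightarrow> (x - 1, y) \<notin> \<Omega>) \<longrightarrow> (left_edge (x, y) \<in> s \<longleftrightarrow> (x, y) \<in> \<Omega>)) \<and>
    (\<forall>x y. ((x, y) \<in> \<Omega> \<longleftrightarrow> (x, y + 1) \<notin> \<Omega>) \<longrightarrow> (top_edge (x, y) \<in> s \<longleftrightarrow> (x, y) \<in> \<Omega>))"
    (is "?L = ?R \<longleftrightarrow> ?C")
proof -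
  have R_left: "left_edge (x, y) \<in> ?R \<longleftrightarrow> (x, y) \<in> \<Omega> \<and> (x - 1, y) \<notin> \<Omega>" for x y
    using leftmost_iff[of x y] by (auto simp: edge_eq_simps)
  have R_top: "top_edge (x, y) \<in> ?R \<longleftrightarrow> (x, y) \<in> \<Omega> \<and> (x, y + 1) \<notin> \<Omega>" for x y
    using uppermost_iff[of x y] by (auto simp: edge_eq_simps)
  have "?R \<subseteq> range left_edge \<union> range top_edge" by blast
  moreover have "?L \<subseteq> range left_edge \<union> range top_edge"
  proof
    fix e assume "e \<in> ?L"
    then have "e \<in> domain_edges \<Omega>" using assms by blast
    then show "e \<in> range left_edge \<union> range top_edge" by (rule edge_cases) auto
  qed
  ultimately have "?L = ?R \<longleftrightarrow>
     (\<forall>e\<in>range left_edge \<union> range top_edge. e \<in> ?L \<longleftrightarrow> e \<in> ?R)"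
    by (rule subset_eq_iff_ball[rotated])
  also have "\<dots> \<longleftrightarrow>
     (\<forall>x y. left_edge (x, y) \<in> ?L \<longleftrightarrow> left_edge (x, y) \<in> ?R) \<and>
     (\<forall>x y. top_edge (x, y) \<in> ?L \<longleftrightarrow> top_edge (x, y) \<in> ?R)"
  proof -
    have ball_range: "(\<forall>e\<in>range f. P e) \<longleftrightarrow> (\<forall>x y. P (f (x, y)))"
      for f :: "point \<Rightarrow> edge" and P
      by (metis rangeI rangeE surj_pair)
    show ?thesis unfolding ball_Un ball_range by (rule refl)
  qed
  also have "\<dots> \<longleftrightarrow> ?C"
  proof -
    have "(occ \<and> (p \<longleftrightarrow> \<not> p') \<longleftrightarrow> p \<and> \<not> p') \<longleftrightarrow> ((p \<longleftrightarrow> \<not> p') \<longrightarrow> (occ \<longleftrightarrow> p))" for occ p p'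
      by blast
    then show ?thesis
      unfolding R_left R_top Int_iff left_edge_in_boundary_edges top_edge_in_boundary_edges
      by (simp only:)
  qed
  finally show ?thesis .
qed

text \<open>Type 6 is excluded at each vertex separately, so it can be merged into the local rule.\<close>

lemma degenerate_configs_iff:
  "s \<in> degenerate_configs \<Omega> \<longleftrightarrow> s \<subseteq> domain_edges \<Omega> \<and>
    (\<forall>(x, y)\<in>\<Omega>. (\<exists>i\<in>{1..6}. has_type s (x, y) i) \<and> \<not> has_type s (x, y) 6) \<and>
    s \<inter> boundary_edges \<Omega> = left_edge ` leftmost \<Omega> \<union> top_edge ` uppermost \<Omega>"
  unfolding degenerate_configs_def six_vertex_configs_def vertices_of_type_def by auto

section \<open>The configuration of a restricted permutation\<close>

lemma restricted_permD:
  assumes "\<sigma> \<in> restricted_perms N \<Omega>"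
  shows "\<sigma> permutes {1..N}" "y \<in> {1..N} \<Longrightarrow> (\<sigma> y, y) \<in> \<Omega>"
    "x \<in> {1..N} \<Longrightarrow> (x, inv \<sigma> x) \<in> \<Omega>" "inv \<sigma> (\<sigma> y) = y" "\<sigma> (inv \<sigma> x) = x"
proof -
  show p: "\<sigma> permutes {1..N}" and r: "y \<in> {1..N} \<Longrightarrow> (\<sigma> y, y) \<in> \<Omega>" for y
    using assms by (auto simp: restricted_perms_def)
  show "inv \<sigma> (\<sigma> y) = y" "\<sigma> (inv \<sigma> x) = x"
    using permutes_inverses[OF p] by auto
  show "(x, inv \<sigma> x) \<in> \<Omega>" if "x \<in> {1..N}"
    using r[of "inv \<sigma> x"] permutes_in_image[OF permutes_inv[OF p], of x]
      permutes_inverses[OF p] that by auto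
qed

text \<open>The rays are taken in the whole plane and cut to the edges of the domain afterwards, so that
  the occupied edges at a vertex can be read off without using the shape of the domain.\<close>

definition config_of_perm :: "(int \<Rightarrow> int) \<Rightarrow> edge set" where
  "config_of_perm \<sigma> = domain_edges \<Omega> \<inter>
     ({left_edge (x, y) | x y. x \<le> \<sigma> y} \<union> {top_edge (x, y) | x y. inv \<sigma> x \<le> y})"

lemma left_edge_in_config_of_perm:
  "left_edge (x, y) \<in> config_of_perm \<sigma> \<longleftrightarrow> ((x, y) \<in> \<Omega> \<or> (x - 1, y) \<in> \<Omega>) \<and> x \<le> \<sigma> y"
  unfolding config_of_perm_def using left_edge_in_domain_edges by (auto simp: edge_eq_simps)

lemma top_edge_in_config_of_perm:
  "top_edge (x, y) \<in> config_of_perm \<sigma> \<longleftrightarrow> ((x, y) \<in> \<Omega> \<or> (x, y + 1) \<in> \<Omega>) \<and> inv \<sigma> x \<le> y"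
  unfolding config_of_perm_def using top_edge_in_domain_edges by (auto simp: edge_eq_simps)

lemma config_of_perm_at_vertex:
  assumes "(x, y) \<in> \<Omega>"
  shows "left_edge (x, y) \<in> config_of_perm \<sigma> \<longleftrightarrow> x \<le> \<sigma> y"
    "left_edge (x + 1, y) \<in> config_of_perm \<sigma> \<longleftrightarrow> x < \<sigma> y"
    "top_edge (x, y - 1) \<in> config_of_perm \<sigma> \<longleftrightarrow> inv \<sigma> x < y"
    "top_edge (x, y) \<in> config_of_perm \<sigma> \<longleftrightarrow> inv \<sigma> x \<le> y"
  using assms by (auto simp: left_edge_in_config_of_perm top_edge_in_config_of_perm)

text \<open>Since \<open>x = \<sigma> y\<close> is equivalent to \<open>inv \<sigma> x = y\<close>, the horizontal and the vertical line through
  \<open>(x, y)\<close> switch there together or not at all; this leaves the four combinations of strict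
  comparisons and Type 5.\<close>

lemma config_of_perm_types:
  assumes \<sigma>: "\<sigma> \<in> restricted_perms N \<Omega>" and p: "(x, y) \<in> \<Omega>"
  shows "has_type (config_of_perm \<sigma>) (x, y) 1 \<longleftrightarrow> \<sigma> y < x \<and> y < inv \<sigma> x"
    "has_type (config_of_perm \<sigma>) (x, y) 2 \<longleftrightarrow> x < \<sigma> y \<and> inv \<sigma> x < y"
    "has_type (config_of_perm \<sigma>) (x, y) 3 \<longleftrightarrow> x < \<sigma> y \<and> y < inv \<sigma> x"
    "has_type (config_of_perm \<sigma>) (x, y) 4 \<longleftrightarrow> \<sigma> y < x \<and> inv \<sigma> x < y"
    "has_type (config_of_perm \<sigma>) (x, y) 5 \<longleftrightarrow> x = \<sigma> y"
    "\<not> has_type (config_of_perm \<sigma>) (x, y) 6"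
proof -
  have "x = \<sigma> y \<longleftrightarrow> inv \<sigma> x = y"
    using restricted_permD(4,5)[OF \<sigma>] by metis
  then show "has_type (config_of_perm \<sigma>) (x, y) 1 \<longleftrightarrow> \<sigma> y < x \<and> y < inv \<sigma> x"
    "has_type (config_of_perm \<sigma>) (x, y) 2 \<longleftrightarrow> x < \<sigma> y \<and> inv \<sigma> x < y"
    "has_type (config_of_perm \<sigma>) (x, y) 3 \<longleftrightarrow> x < \<sigma> y \<and> y < inv \<sigma> x"
    "has_type (config_of_perm \<sigma>) (x, y) 4 \<longleftrightarrow> \<sigma> y < x \<and> inv \<sigma> x < y"
    "has_type (config_of_perm \<sigma>) (x, y) 5 \<longleftrightarrow> x = \<sigma> y"
    "\<not> has_type (config_of_perm \<sigma>) (x, y) 6"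
    unfolding has_type_iff config_of_perm_at_vertex[OF p] by (auto simp: order.order_iff_strict)
qed

lemma type_5_config_of_perm:
  assumes \<sigma>: "\<sigma> \<in> restricted_perms N \<Omega>"
  shows "vertices_of_type \<Omega> 5 (config_of_perm \<sigma>) = perm_points N \<sigma>"
  using config_of_perm_types(5)[OF \<sigma>] restricted_permD(2)[OF \<sigma>] inside_square
  unfolding vertices_of_type_def perm_points_def by auto

text \<open>The segment of the domain in each row contains the permutation point of that row, so a ray
  running to the left covers the left boundary edge and misses the right one; similarly for
  columns.\<close>

lemma config_of_perm_degenerate:
  assumes \<sigma>: "\<sigma> \<in> restricted_perms N \<Omega>"
  shows "config_of_perm \<sigma> \<in> degenerate_configs \<Omega>"
proof -
  have sub: "config_of_perm \<sigma> \<subseteq> domain_edges \<Omega>"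
    by (auto simp: config_of_perm_def)
  have types: "(\<exists>i\<in>{1..6}. has_type (config_of_perm \<sigma>) (x, y) i) \<and>
      \<not> has_type (config_of_perm \<sigma>) (x, y) 6" if p: "(x, y) \<in> \<Omega>" for x y
  proof -
    have "x = \<sigma> y \<longleftrightarrow> inv \<sigma> x = y"
      using restricted_permD(4,5)[OF \<sigma>] by metis
    then show ?thesis
      using config_of_perm_types(6)[OF \<sigma> p]
      unfolding ex_type_1_6 config_of_perm_types(1-5)[OF \<sigma> p] by (meson linorder_neqE)
  qed
  have rows: "left_edge (x, y) \<in> config_of_perm \<sigma> \<longleftrightarrow> (x, y) \<in> \<Omega>"
    if b: "(x, y) \<in> \<Omega> \<longleftrightarrow> (x - 1, y) \<notin> \<Omega>" for x y
  proof -
    consider "(x, y) \<in> \<Omega>" "(x - 1, y) \<notin> \<Omega>" | "(x, y) \<notin> \<Omega>" "(x - 1, y) \<in> \<Omega>"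
      using b by blast
    then show ?thesis
    proof cases
      case 1
      then have "(\<sigma> y, y) \<in> \<Omega>" using restricted_permD(2)[OF \<sigma>] inside_square by blast
      then have "x \<le> \<sigma> y" using row_convex[of "\<sigma> y" y x "x - 1"] 1 by force
      then show ?thesis using 1 by (simp add: left_edge_in_config_of_perm)
    next
      case 2
      then have "(\<sigma> y, y) \<in> \<Omega>" using restricted_permD(2)[OF \<sigma>] inside_square by blast
      then have "\<not> x \<le> \<sigma> y" using row_convex[of "x - 1" y "\<sigma> y" x] 2 by force
      then show ?thesis using 2 by (simp add: left_edge_in_config_of_perm)
    qed
  qed
  have columns: "top_edge (x, y) \<in> config_of_perm \<sigma> \<longleftrightarrow> (x, y) \<in> \<Omega>"
    if b: "(x, y) \<in> \<Omega> \<longleftrightarrow> (x, y + 1) \<notin> \<Omega>" for x y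
  proof -
    consider "(x, y) \<in> \<Omega>" "(x, y + 1) \<notin> \<Omega>" | "(x, y) \<notin> \<Omega>" "(x, y + 1) \<in> \<Omega>"
      using b by blast
    then show ?thesis
    proof cases
      case 1
      then have "(x, inv \<sigma> x) \<in> \<Omega>" using restricted_permD(3)[OF \<sigma>] inside_square by blast
      then have "inv \<sigma> x \<le> y" using column_convex[of x y "inv \<sigma> x" "y + 1"] 1 by force
      then show ?thesis using 1 by (simp add: top_edge_in_config_of_perm)
    next
      case 2
      then have "(x, inv \<sigma> x) \<in> \<Omega>" using restricted_permD(3)[OF \<sigma>] inside_square by blast
      then have "\<not> inv \<sigma> x \<le> y" using column_convex[of x "inv \<sigma> x" "y + 1" y] 2 by force
      then show ?thesis using 2 by (simp add: top_edge_in_config_of_perm)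
    qed
  qed
  show ?thesis
    unfolding degenerate_configs_iff boundary_condition_iff[OF sub]
  proof (intro conjI ballI allI impI)
    show "case p of (x, y) \<Rightarrow> (\<exists>i\<in>{1..6}. has_type (config_of_perm \<sigma>) (x, y) i) \<and>
        \<not> has_type (config_of_perm \<sigma>) (x, y) 6" if "p \<in> \<Omega>" for p
      using types that by (cases p) blast
    show "left_edge (x, y) \<in> config_of_perm \<sigma> \<longleftrightarrow> (x, y) \<in> \<Omega>"
      if "(x, y) \<in> \<Omega> \<longleftrightarrow> (x - 1, y) \<notin> \<Omega>" for x y
      by (rule rows[OF that])
    show "top_edge (x, y) \<in> config_of_perm \<sigma> \<longleftrightarrow> (x, y) \<in> \<Omega>"
      if "(x, y) \<in> \<Omega> \<longleftrightarrow> (x, y + 1) \<notin> \<Omega>" for x y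
      by (rule columns[OF that])
  qed (rule sub)
qed

end

section \<open>The permutation of a configuration\<close>

text \<open>Applied to rows with \<open>P\<close> the occupation of left edges, and to columns with \<open>P\<close> the
  vacancy of bottom edges.\<close>

lemma single_switch:
  fixes L R :: int
  assumes LR: "L \<le> R" and P_L: "P L" and P_R: "\<not> P (R + 1)"
    and step: "\<And>x. L \<le> x \<Longrightarrow> x \<le> R \<Longrightarrow> P (x + 1) \<Longrightarrow> P x"
  shows "\<exists>c. L \<le> c \<and> c \<le> R \<and> (\<forall>x. L \<le> x \<and> x \<le> R + 1 \<longrightarrow> (P x \<longleftrightarrow> x \<le> c))"
proof -
  define A where "A = {x \<in> {L..R}. P x}"
  have "finite A" by (rule finite_subset[of _ "{L..R}"]) (auto simp: A_def)
  have "A \<noteq> {}" using LR P_L by (auto simp: A_def)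
  define c where "c = Max A"
  have "c \<in> A" and c_max: "\<And>x. x \<in> A \<Longrightarrow> x \<le> c"
    using \<open>finite A\<close> \<open>A \<noteq> {}\<close> by (auto simp: c_def)
  then have c: "L \<le> c" "c \<le> R" "P c" by (auto simp: A_def)
  have down: "P x" if "x \<le> c" "L \<le> x" for x
  proof -
    have "L \<le> x \<longrightarrow> P x" using that(1)
    proof (induction x rule: int_le_induct)
      case base then show ?case using c by simp
    next
      case (step i) then show ?case using assms(4)[of "i - 1"] c by auto
    qed
    then show ?thesis using that by simp
  qed
  have "P x \<longleftrightarrow> x \<le> c" if "L \<le> x" "x \<le> R + 1" for x
  proof
    assume "P x"
    then have "x \<noteq> R + 1" using P_R by auto
    then show "x \<le> c" using \<open>P x\<close> that by (intro c_max) (auto simp: A_def)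
  qed (use down that in auto)
  then show ?thesis using c by blast
qed

context segmented_domain
begin

text \<open>Let \<open>c y\<close> be the abscissa where row \<open>y\<close> switches, and \<open>d x\<close> the ordinate where column \<open>x\<close>
  switches. A switch of either kind makes the vertex a Type 5 vertex, so that \<open>c\<close> and \<open>d\<close> are
  inverse to each other, and \<open>c\<close>, extended by the identity, is the permutation.\<close>

lemma config_of_perm_surj:
  assumes s: "s \<in> degenerate_configs \<Omega>"
  shows "\<exists>\<sigma>\<in>restricted_perms N \<Omega>. s = config_of_perm \<sigma>"
proof -
  have sub: "s \<subseteq> domain_edges \<Omega>"
    and bc: "s \<inter> boundary_edges \<Omega> = left_edge ` leftmost \<Omega> \<union> top_edge ` uppermost \<Omega>"
    and vertex: "\<And>x y. (x, y) \<in> \<Omega> \<Longrightarrow>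
      (left_edge (x, y) \<in> s \<longleftrightarrow> left_edge (x + 1, y) \<in> s) \<and>
      (top_edge (x, y - 1) \<in> s \<longleftrightarrow> top_edge (x, y) \<in> s) \<or>
      left_edge (x, y) \<in> s \<and> left_edge (x + 1, y) \<notin> s \<and>
      top_edge (x, y - 1) \<notin> s \<and> top_edge (x, y) \<in> s"
    using s unfolding degenerate_configs_iff allowed_vertex_iff by auto
  have bc_left: "left_edge (x, y) \<in> s \<longleftrightarrow> (x, y) \<in> \<Omega>"
    if "(x, y) \<in> \<Omega> \<longleftrightarrow> (x - 1, y) \<notin> \<Omega>" for x y
    using bc that unfolding boundary_condition_iff[OF sub] by blast
  have bc_top: "top_edge (x, y) \<in> s \<longleftrightarrow> (x, y) \<in> \<Omega>"
    if "(x, y) \<in> \<Omega> \<longleftrightarrow> (x, y + 1) \<notin> \<Omega>" for x y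
    using bc that unfolding boundary_condition_iff[OF sub] by blast

  have "\<exists>c. (c, y) \<in> \<Omega> \<and> (\<forall>x. (x, y) \<in> \<Omega> \<longrightarrow>
      (left_edge (x, y) \<in> s \<longleftrightarrow> x \<le> c) \<and> (left_edge (x + 1, y) \<in> s \<longleftrightarrow> x < c))"
    if y: "y \<in> {1..N}" for y
  proof -
    obtain L R where LR: "L \<le> R" and row: "\<And>x. (x, y) \<in> \<Omega> \<longleftrightarrow> L \<le> x \<and> x \<le> R"
      using row_segment[OF y] by blast
    have "\<exists>c. L \<le> c \<and> c \<le> R \<and>
        (\<forall>x. L \<le> x \<and> x \<le> R + 1 \<longrightarrow> (left_edge (x, y) \<in> s \<longleftrightarrow> x \<le> c))"
    proof (rule single_switch[OF LR])
      show "left_edge (L, y) \<in> s" "left_edge (R + 1, y) \<notin> s"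
        using bc_left[of L y] bc_left[of "R + 1" y] LR by (simp_all add: row)
      show "left_edge (x, y) \<in> s" if "L \<le> x" "x \<le> R" "left_edge (x + 1, y) \<in> s" for x
        using vertex[of x y] that row by blast
    qed
    then obtain c where c: "L \<le> c" "c \<le> R"
      "\<And>x. L \<le> x \<Longrightarrow> x \<le> R + 1 \<Longrightarrow> left_edge (x, y) \<in> s \<longleftrightarrow> x \<le> c" by blast
    have "(left_edge (x, y) \<in> s \<longleftrightarrow> x \<le> c) \<and> (left_edge (x + 1, y) \<in> s \<longleftrightarrow> x < c)"
      if "(x, y) \<in> \<Omega>" for x
      using that c(3)[of x] c(3)[of "x + 1"] row by auto
    then show ?thesis using c row by blast
  qed
  then obtain c where c_in: "\<And>y. y \<in> {1..N} \<Longrightarrow> (c y, y) \<in> \<Omega>"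
    and c_left: "\<And>x y. y \<in> {1..N} \<Longrightarrow> (x, y) \<in> \<Omega> \<Longrightarrow> left_edge (x, y) \<in> s \<longleftrightarrow> x \<le> c y"
    and c_right: "\<And>x y. y \<in> {1..N} \<Longrightarrow> (x, y) \<in> \<Omega> \<Longrightarrow> left_edge (x + 1, y) \<in> s \<longleftrightarrow> x < c y"
    by metis

  have "\<exists>d. (x, d) \<in> \<Omega> \<and> (\<forall>y. (x, y) \<in> \<Omega> \<longrightarrow>
      (top_edge (x, y - 1) \<in> s \<longleftrightarrow> d < y) \<and> (top_edge (x, y) \<in> s \<longleftrightarrow> d \<le> y))"
    if x: "x \<in> {1..N}" for x
  proof -
    obtain L R where LR: "L \<le> R" and column: "\<And>y. (x, y) \<in> \<Omega> \<longleftrightarrow> L \<le> y \<and> y \<le> R"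
      using column_segment[OF x] by blast
    have "\<exists>d. L \<le> d \<and> d \<le> R \<and>
        (\<forall>y. L \<le> y \<and> y \<le> R + 1 \<longrightarrow> (top_edge (x, y - 1) \<notin> s \<longleftrightarrow> y \<le> d))"
    proof (rule single_switch[OF LR])
      show "top_edge (x, L - 1) \<notin> s" "\<not> top_edge (x, R + 1 - 1) \<notin> s"
        using bc_top[of x "L - 1"] bc_top[of x R] LR by (simp_all add: column)
      show "top_edge (x, y - 1) \<notin> s" if "L \<le> y" "y \<le> R" "top_edge (x, y + 1 - 1) \<notin> s" for y
        using vertex[of x y] that column by auto
    qed
    then obtain d where d: "L \<le> d" "d \<le> R"
      "\<And>y. L \<le> y \<Longrightarrow> y \<le> R + 1 \<Longrightarrow> top_edge (x, y - 1) \<notin> s \<longleftrightarrow> y \<le> d" by blast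
    have "(top_edge (x, y - 1) \<in> s \<longleftrightarrow> d < y) \<and> (top_edge (x, y) \<in> s \<longleftrightarrow> d \<le> y)"
      if "(x, y) \<in> \<Omega>" for y
      using that d(3)[of y] d(3)[of "y + 1"] column by auto
    then show ?thesis using d column by blast
  qed
  then obtain d where d_in: "\<And>x. x \<in> {1..N} \<Longrightarrow> (x, d x) \<in> \<Omega>"
    and d_bottom: "\<And>x y. x \<in> {1..N} \<Longrightarrow> (x, y) \<in> \<Omega> \<Longrightarrow> top_edge (x, y - 1) \<in> s \<longleftrightarrow> d x < y"
    and d_top: "\<And>x y. x \<in> {1..N} \<Longrightarrow> (x, y) \<in> \<Omega> \<Longrightarrow> top_edge (x, y) \<in> s \<longleftrightarrow> d x \<le> y"
    by metis

  have in_square: "x \<in> {1..N} \<and> y \<in> {1..N}" if "(x, y) \<in> \<Omega>" for x y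
    using that inside_square by auto
  have dc: "d (c y) = y" if y: "y \<in> {1..N}" for y
  proof -
    note p = c_in[OF y]
    have x: "c y \<in> {1..N}" using in_square[OF p] by blast
    show ?thesis
      using vertex[OF p] unfolding c_left[OF y p] c_right[OF y p] d_bottom[OF x p] d_top[OF x p]
      by linarith
  qed
  have cd: "c (d x) = x" if x: "x \<in> {1..N}" for x
  proof -
    note p = d_in[OF x]
    have y: "d x \<in> {1..N}" using in_square[OF p] by blast
    show ?thesis
      using vertex[OF p] unfolding c_left[OF y p] c_right[OF y p] d_bottom[OF x p] d_top[OF x p]
      by linarith
  qed
  define \<sigma> where "\<sigma> = (\<lambda>m. if m \<in> {1..N} then c m else m)"
  have perm: "\<sigma> permutes {1..N}"
  proof (rule bij_imp_permutes)
    have "bij_betw c {1..N} {1..N}"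
      using dc cd c_in d_in in_square by (intro bij_betwI[of c _ _ d]) blast+
    then show "bij_betw \<sigma> {1..N} {1..N}"
      using bij_betw_cong[of "{1..N}" \<sigma> c "{1..N}"] by (simp add: \<sigma>_def)
  qed (auto simp: \<sigma>_def)
  have \<sigma>: "\<sigma> \<in> restricted_perms N \<Omega>"
    unfolding restricted_perms_def using perm c_in by (simp add: \<sigma>_def)
  have inv_\<sigma>: "inv \<sigma> x = d x" if "x \<in> {1..N}" for x
  proof -
    have "d x \<in> {1..N}" using d_in[OF that] in_square by blast
    then have "\<sigma> (d x) = x" using cd[OF that] by (simp add: \<sigma>_def)
    then show ?thesis using permutes_inv_eq[OF perm] by blast
  qed
  have "s = config_of_perm \<sigma>"
  proof (rule edge_set_eqI[OF sub])
    show "config_of_perm \<sigma> \<subseteq> domain_edges \<Omega>" by (simp add: config_of_perm_def)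
    fix p assume "p \<in> \<Omega>"
    then obtain x y where p: "p = (x, y)" "(x, y) \<in> \<Omega>" by (cases p) auto
    have xy: "x \<in> {1..N}" "y \<in> {1..N}" using in_square[OF p(2)] by auto
    then have "\<sigma> y = c y" by (simp add: \<sigma>_def)
    then have "e \<in> s \<longleftrightarrow> e \<in> config_of_perm \<sigma>" if "e \<in> incident_edges (x, y)" for e
      using that config_of_perm_at_vertex[OF p(2), of \<sigma>] inv_\<sigma>[OF xy(1)]
        c_left[OF xy(2) p(2)] c_right[OF xy(2) p(2)] d_bottom[OF xy(1) p(2)] d_top[OF xy(1) p(2)]
      unfolding incident_edges_conv by auto
    then show "s \<inter> incident_edges p = config_of_perm \<sigma> \<inter> incident_edges p"
      using p by blast
  qed
  then show ?thesis using \<sigma> by blast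
qed

lemma perm_points_inj:
  assumes "\<sigma> \<in> restricted_perms N \<Omega>" "\<tau> \<in> restricted_perms N \<Omega>"
    and "perm_points N \<sigma> = perm_points N \<tau>"
  shows "\<sigma> = \<tau>"
proof
  fix m
  show "\<sigma> m = \<tau> m"
  proof (cases "m \<in> {1..N}")
    case True
    then have "(\<sigma> m, m) \<in> perm_points N \<tau>"
      using assms(3) by (auto simp: perm_points_def)
    then show ?thesis by (auto simp: perm_points_def)
  next
    case False
    then show ?thesis using assms(1,2) by (auto simp: restricted_perms_def permutes_def)
  qed
qed

lemma bij_betw_config_of_perm:
  "bij_betw config_of_perm (restricted_perms N \<Omega>) (degenerate_configs \<Omega>)"
proof (rule bij_betwI')
  show "config_of_perm \<sigma> = config_of_perm \<tau> \<longleftrightarrow> \<sigma> = \<tau>"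
    if "\<sigma> \<in> restricted_perms N \<Omega>" "\<tau> \<in> restricted_perms N \<Omega>" for \<sigma> \<tau>
    using that type_5_config_of_perm perm_points_inj by metis
qed (use config_of_perm_degenerate config_of_perm_surj in blast)+

end

section \<open>Weights and inversions\<close>

text \<open>An inversion \<open>(i, j)\<close> is seen from the two remaining corners of the rectangle spanned by
  its permutation points, namely from \<open>(\<sigma> j, i)\<close> and from \<open>(\<sigma> i, j)\<close>.\<close>

lemma bij_betw_inversion_corners:
  fixes \<sigma> \<tau> :: "'a::linorder \<Rightarrow> 'a"
  assumes inverses: "\<And>x. \<sigma> (\<tau> x) = x" "\<And>x. \<tau> (\<sigma> x) = x"
    and mem: "\<And>x. \<sigma> x \<in> S \<longleftrightarrow> x \<in> S" "\<And>x. \<tau> x \<in> S \<longleftrightarrow> x \<in> S"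
  shows "bij_betw (\<lambda>(i, j). (\<sigma> j, i)) {(i, j). i \<in> S \<and> j \<in> S \<and> i < j \<and> \<sigma> i > \<sigma> j}
      {(x, y) \<in> S \<times> S. x < \<sigma> y \<and> y < \<tau> x}"
    and "bij_betw (\<lambda>(i, j). (\<sigma> i, j)) {(i, j). i \<in> S \<and> j \<in> S \<and> i < j \<and> \<sigma> i > \<sigma> j}
      {(x, y) \<in> S \<times> S. \<sigma> y < x \<and> \<tau> x < y}"
  subgoal
    by (rule bij_betw_byWitness[where f' = "\<lambda>(x, y). (y, \<tau> x)"]) (auto simp: inverses mem)
  subgoal
    by (rule bij_betw_byWitness[where f' = "\<lambda>(x, y). (\<tau> x, y)"]) (auto simp: inverses mem)
  done

context segmented_domain
begin

text \<open>The points of the square for which the permutation points of their row and of their column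
  form an inversion; inside the domain these are the vertices of Types 3 and 4.\<close>

definition crossed_points :: "(int \<Rightarrow> int) \<Rightarrow> point set" where
  "crossed_points \<sigma> = {(x, y) \<in> {1..N} \<times> {1..N}.
     x < \<sigma> y \<and> y < inv \<sigma> x \<or> \<sigma> y < x \<and> inv \<sigma> x < y}"

lemma finite_crossed_points: "finite (crossed_points \<sigma>)"
  by (rule finite_subset[of _ "{1..N} \<times> {1..N}"]) (auto simp: crossed_points_def)

lemma card_crossed_points:
  assumes "\<sigma> permutes {1..N}"
  shows "card (crossed_points \<sigma>) = 2 * inversions N \<sigma>"
proof -
  let ?A = "{(x, y) \<in> {1..N} \<times> {1..N}. x < \<sigma> y \<and> y < inv \<sigma> x}"
  let ?B = "{(x, y) \<in> {1..N} \<times> {1..N}. \<sigma> y < x \<and> inv \<sigma> x < y}"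
  note corners = bij_betw_inversion_corners[of \<sigma> "inv \<sigma>", OF permutes_inverses[OF assms]
    permutes_in_image[OF assms] permutes_in_image[OF permutes_inv[OF assms]]]
  have A: "card ?A = inversions N \<sigma>"
    unfolding inversions_def by (rule bij_betw_same_card[OF corners(1), symmetric])
  have B: "card ?B = inversions N \<sigma>"
    unfolding inversions_def by (rule bij_betw_same_card[OF corners(2), symmetric])
  have "finite ?A" "finite ?B"
    by (rule finite_subset[of _ "{1..N} \<times> {1..N}"]; auto)+
  moreover have "crossed_points \<sigma> = ?A \<union> ?B" "?A \<inter> ?B = {}"
    by (auto simp: crossed_points_def)
  ultimately show ?thesis using A B by (simp add: card_Un_disjoint)
qed

text \<open>Seen from a point outside the domain, the segment of its row lies on one side, and the
  permutation point of the row lies in that segment; similarly for the column.\<close>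

lemma crossed_points_outside:
  assumes "\<sigma> \<in> restricted_perms N \<Omega>" "\<tau> \<in> restricted_perms N \<Omega>"
  shows "crossed_points \<sigma> - \<Omega> = crossed_points \<tau> - \<Omega>"
proof -
  have "(x < \<sigma> y \<longleftrightarrow> x < \<tau> y) \<and> (\<sigma> y < x \<longleftrightarrow> \<tau> y < x) \<and>
      (y < inv \<sigma> x \<longleftrightarrow> y < inv \<tau> x) \<and> (inv \<sigma> x < y \<longleftrightarrow> inv \<tau> x < y)"
    if "x \<in> {1..N}" "y \<in> {1..N}" "(x, y) \<notin> \<Omega>" for x y
  proof -
    have in_row: "(\<sigma> y, y) \<in> \<Omega>" "(\<tau> y, y) \<in> \<Omega>"
      and in_column: "(x, inv \<sigma> x) \<in> \<Omega>" "(x, inv \<tau> x) \<in> \<Omega>"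
      using assms restricted_permD(2,3) that by auto
    have "\<not> (\<sigma> y \<le> x \<and> x \<le> \<tau> y)" "\<not> (\<tau> y \<le> x \<and> x \<le> \<sigma> y)"
      using row_convex in_row that(3) by blast+
    moreover have "\<not> (inv \<sigma> x \<le> y \<and> y \<le> inv \<tau> x)" "\<not> (inv \<tau> x \<le> y \<and> y \<le> inv \<sigma> x)"
      using column_convex in_column that(3) by blast+
    ultimately show ?thesis by linarith
  qed
  then show ?thesis by (auto simp: crossed_points_def)
qed

lemma config_weight_positive: "a > 0 \<Longrightarrow> b > 0 \<Longrightarrow> config_weight \<Omega> a b s > 0"
  unfolding config_weight_def
  by (intro prod_pos zero_less_power ballI)
    (auto simp: degenerate_weight_def nth_Cons' numeral_eq_Suc)

lemma config_weight_expand: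
  "config_weight \<Omega> a b s =
    a ^ (card (vertices_of_type \<Omega> 1 s) + card (vertices_of_type \<Omega> 2 s)) *
    b ^ (card (vertices_of_type \<Omega> 3 s) + card (vertices_of_type \<Omega> 4 s))"
proof -
  have "{1..5::nat} = {1, 2, 3, 4, 5}" by auto
  then show ?thesis
    by (simp add: config_weight_def degenerate_weight_def power_add mult.assoc)
qed

lemma card_perm_points: "card (perm_points N \<sigma>) = card {1..N}"
proof -
  have "perm_points N \<sigma> = (\<lambda>m. (\<sigma> m, m)) ` {1..N}" by (auto simp: perm_points_def)
  then show ?thesis by (simp add: card_image inj_on_def)
qed

text \<open>The numbers of vertices of Types 1 and 2 and of Types 3 and 4 add up to \<open>|\<Omega>| - N\<close>, since there
  is one Type 5 vertex per row. So the weight depends only on the number \<open>m\<close> of vertices of Types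
  3 and 4, as \<open>(b / a) ^ m\<close>. Here \<open>m\<close> is \<open>2 inv(\<sigma>)\<close> minus the number of crossed points outside
  the domain, which can be computed from any fixed restricted permutation.\<close>

lemma config_weight_eq:
  assumes nonempty: "restricted_perms N \<Omega> \<noteq> {}" and ab: "a > 0" "b > 0"
  shows "\<exists>K>0. \<forall>\<sigma>\<in>restricted_perms N \<Omega>.
    config_weight \<Omega> a b (config_of_perm \<sigma>) = K * (b\<^sup>2 / a\<^sup>2) ^ inversions N \<sigma>"
proof -
  obtain \<sigma>0 where \<sigma>0: "\<sigma>0 \<in> restricted_perms N \<Omega>" using nonempty by blast
  define c where "c = card (crossed_points \<sigma>0 - \<Omega>)"
  define K where "K = a ^ (card \<Omega> - card {1..N}) / (b / a) ^ c"
  have "config_weight \<Omega> a b (config_of_perm \<sigma>) = K * (b\<^sup>2 / a\<^sup>2) ^ inversions N \<sigma>"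
    if \<sigma>: "\<sigma> \<in> restricted_perms N \<Omega>" for \<sigma>
  proof -
    let ?V = "\<lambda>i. vertices_of_type \<Omega> i (config_of_perm \<sigma>)"
    note types = config_of_perm_types[OF \<sigma>]
    have V: "?V 1 = {(x, y) \<in> \<Omega>. \<sigma> y < x \<and> y < inv \<sigma> x}"
      "?V 2 = {(x, y) \<in> \<Omega>. x < \<sigma> y \<and> inv \<sigma> x < y}"
      "?V 3 = {(x, y) \<in> \<Omega>. x < \<sigma> y \<and> y < inv \<sigma> x}"
      "?V 4 = {(x, y) \<in> \<Omega>. \<sigma> y < x \<and> inv \<sigma> x < y}"
      "?V 5 = {(x, y) \<in> \<Omega>. x = \<sigma> y}"
      unfolding vertices_of_type_def using types by auto
    have fin: "finite (?V i)" for i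
      using finite_domain by (simp add: vertices_of_type_def)
    have eq_iff: "x = \<sigma> y \<longleftrightarrow> inv \<sigma> x = y" for x y
      using restricted_permD(4,5)[OF \<sigma>] by metis
    have crossed: "card (?V 3) + card (?V 4) = card (crossed_points \<sigma> \<inter> \<Omega>)"
    proof -
      have "crossed_points \<sigma> \<inter> \<Omega> = ?V 3 \<union> ?V 4"
        unfolding V crossed_points_def using inside_square by auto
      moreover have "?V 3 \<inter> ?V 4 = {}" unfolding V by auto
      ultimately show ?thesis using fin by (simp add: card_Un_disjoint)
    qed
    have uncrossed: "card (?V 1) + card (?V 2) = card (\<Omega> - crossed_points \<sigma> - ?V 5)"
    proof -
      have "\<Omega> - crossed_points \<sigma> - ?V 5 = ?V 1 \<union> ?V 2"
        unfolding V crossed_points_def using inside_square eq_iff by fastforce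
      moreover have "?V 1 \<inter> ?V 2 = {}" unfolding V by auto
      ultimately show ?thesis using fin by (simp add: card_Un_disjoint)
    qed
    define m where "m = card (?V 3) + card (?V 4)"
    define n where "n = card (?V 1) + card (?V 2)"
    have "m + c = card (crossed_points \<sigma>)"
      unfolding m_def crossed c_def crossed_points_outside[OF \<sigma>0 \<sigma>]
      by (rule card_Int_Diff[OF finite_crossed_points, symmetric])
    then have m: "m + c = 2 * inversions N \<sigma>"
      using card_crossed_points restricted_permD(1)[OF \<sigma>] by simp
    have "card \<Omega> = card (crossed_points \<sigma> \<inter> \<Omega>) + card (\<Omega> - crossed_points \<sigma>)"
      using card_Int_Diff[OF finite_domain, of "crossed_points \<sigma>"] by (simp add: Int_commute)
    also have "card (\<Omega> - crossed_points \<sigma>) =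
        card (?V 5) + card (\<Omega> - crossed_points \<sigma> - ?V 5)"
    proof -
      have "?V 5 \<subseteq> \<Omega> - crossed_points \<sigma>" unfolding V crossed_points_def by auto
      then show ?thesis
        using finite_domain fin by (simp add: card_Diff_subset card_mono)
    qed
    finally have "card \<Omega> = m + (card {1..N} + n)"
      unfolding m_def n_def crossed uncrossed type_5_config_of_perm[OF \<sigma>] card_perm_points .
    then have n: "card \<Omega> - card {1..N} = n + m" by simp
    have "a ^ n * b ^ m = a ^ (n + m) * (b / a) ^ m"
      using ab by (simp add: power_add power_divide)
    also have "(b / a) ^ m = (b / a) ^ (m + c) / (b / a) ^ c"
      using ab by (simp add: power_add)
    also have "(b / a) ^ (m + c) = (b\<^sup>2 / a\<^sup>2) ^ inversions N \<sigma>"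
      unfolding m by (simp add: power_mult power_divide)
    finally show ?thesis
      unfolding config_weight_expand K_def n by (simp add: m_def n_def)
  qed
  moreover have "K > 0" using ab by (simp add: K_def)
  ultimately show ?thesis by blast
qed

end

section \<open>Array domains have segments as rows and columns\<close>

lemma grid_partition_mono:
  assumes "grid_partition N k X" "u \<le> u'" "u' \<le> k"
  shows "X u \<le> X u'"
  using assms(2,3)
proof (induction u' rule: dec_induct)
  case (step n)
  then have "X (Suc n - 1) < X (Suc n)" using assms(1) unfolding grid_partition_def by force
  then show ?case using step by simp
qed simp

lemma grid_partition_cell:
  assumes "grid_partition N k X" "0 < x" "x \<le> N"
  shows "\<exists>u\<in>{1..k}. X (u - 1) < x \<and> x \<le> X u"
proof -
  define u where "u = (LEAST u. x \<le> X u)"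
  have "x \<le> X k" "X 0 < x" using assms by (auto simp: grid_partition_def)
  then have u: "x \<le> X u" "u \<le> k" unfolding u_def by (auto intro: LeastI Least_le)
  with \<open>X 0 < x\<close> have "0 < u" by (cases u) auto
  then have "\<not> x \<le> X (u - 1)" using not_less_Least[of "u - 1" "\<lambda>u. x \<le> X u"] by (simp add: u_def)
  then show ?thesis using u \<open>0 < u\<close> by (intro bexI[of _ u]) auto
qed

lemma grid_partition_cell_unique:
  assumes "grid_partition N k X" "u \<in> {1..k}" "u' \<in> {1..k}"
    and "X (u - 1) < x" "x \<le> X u" "X (u' - 1) < x" "x \<le> X u'"
  shows "u = u'"
proof (rule ccontr)
  assume "u \<noteq> u'"
  then consider "u \<le> u' - 1" | "u' \<le> u - 1" by linarith
  then show False
    using grid_partition_mono[OF assms(1), of u "u' - 1"]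
      grid_partition_mono[OF assms(1), of u' "u - 1"] assms(2-) by cases force+
qed

text \<open>A row of lattice points meets only the cells of one row of the array. The array entries equal
  to 1 there have consecutive indices \<open>c, \<dots>, d\<close>, and the intervals belonging to these indices
  fit together to the single interval from \<open>X (c - 1) + 1\<close> to \<open>X d\<close>. The columns are handled by
  transposing the array.\<close>

lemma array_domain_row:
  assumes X: "grid_partition N k X" and Y: "grid_partition N l Y" and I: "convex_array k l I"
    and y: "y \<in> {1..N}"
  shows "\<exists>c d. c \<le> d \<and> (\<forall>x. (x, y) \<in> array_domain k l X Y I \<longleftrightarrow> c \<le> x \<and> x \<le> d)"
proof -
  obtain v where v: "v \<in> {1..l}" "Y (v - 1) < y" "y \<le> Y v"
    using grid_partition_cell[OF Y, of y] y by auto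
  obtain c d where cd: "c \<le> d" "{u \<in> {1..k}. I u v = 1} = {c..d}"
    using I v(1) unfolding convex_array_def by blast
  have "c \<in> {c..d}" "d \<in> {c..d}" using cd(1) by auto
  then have range: "c \<in> {1..k}" "d \<in> {1..k}" unfolding cd(2)[symmetric] by auto
  have "(x, y) \<in> array_domain k l X Y I \<longleftrightarrow> X (c - 1) + 1 \<le> x \<and> x \<le> X d" for x
  proof
    assume "(x, y) \<in> array_domain k l X Y I"
    then obtain u v' where u: "u \<in> {1..k}" "X (u - 1) < x" "x \<le> X u" and "I u v' = 1"
      and "v' \<in> {1..l}" "Y (v' - 1) < y" "y \<le> Y v'"
      unfolding array_domain_def by auto
    moreover from this have "v' = v" using grid_partition_cell_unique[OF Y] v by blast
    ultimately have "u \<in> {c..d}" unfolding cd(2)[symmetric] by auto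
    then have "X (c - 1) \<le> X (u - 1)" "X u \<le> X d"
      using range u(1) by (auto intro!: grid_partition_mono[OF X])
    then show "X (c - 1) + 1 \<le> x \<and> x \<le> X d" using u by linarith
  next
    assume x: "X (c - 1) + 1 \<le> x \<and> x \<le> X d"
    moreover have "X 0 \<le> X (c - 1)" "X d \<le> X k"
      using range by (auto intro!: grid_partition_mono[OF X])
    moreover have "X 0 = 0" "X k = N" using X by (auto simp: grid_partition_def)
    ultimately obtain u where u: "u \<in> {1..k}" "X (u - 1) < x" "x \<le> X u"
      using grid_partition_cell[OF X, of x] by auto
    have "c \<le> u"
    proof (rule ccontr)
      assume "\<not> c \<le> u"
      then have "X u \<le> X (c - 1)" using range by (intro grid_partition_mono[OF X]) auto
      then show False using x u by linarith
    qed
    moreover have "u \<le> d"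
    proof (rule ccontr)
      assume "\<not> u \<le> d"
      then have "X d \<le> X (u - 1)" using u(1) by (intro grid_partition_mono[OF X]) auto
      then show False using x u by linarith
    qed
    ultimately have "u \<in> {c..d}" by simp
    then have "I u v = 1" unfolding cd(2)[symmetric] by simp
    then show "(x, y) \<in> array_domain k l X Y I"
      unfolding array_domain_def mem_Collect_eq prod.case using u v by blast
  qed
  moreover have "X (c - 1) + 1 \<le> X d"
  proof -
    have "X (c - 1) < X c" using X range(1) by (auto simp: grid_partition_def)
    moreover have "X c \<le> X d" using cd(1) range by (intro grid_partition_mono[OF X]) auto
    ultimately show ?thesis by linarith
  qed
  ultimately show ?thesis by blast
qed

lemma convex_array_transpose: "convex_array k l I \<Longrightarrow> convex_array l k (\<lambda>v u. I u v)"
  unfolding convex_array_def by blast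

lemma array_domain_transpose:
  "(y, x) \<in> array_domain l k Y X (\<lambda>v u. I u v) \<longleftrightarrow> (x, y) \<in> array_domain k l X Y I"
  unfolding array_domain_def by blast

lemma segmented_array_domain:
  assumes X: "grid_partition N k X" and Y: "grid_partition N l Y" and I: "convex_array k l I"
  shows "segmented_domain N (array_domain k l X Y I)"
proof
  show "array_domain k l X Y I \<subseteq> {1..N} \<times> {1..N}"
  proof (rule subrelI)
    fix x y assume "(x, y) \<in> array_domain k l X Y I"
    then obtain u v where uv: "u \<in> {1..k}" "v \<in> {1..l}"
      "X (u - 1) < x" "x \<le> X u" "Y (v - 1) < y" "y \<le> Y v"
      unfolding array_domain_def by auto
    moreover have "X 0 \<le> X (u - 1)" "X u \<le> X k" "Y 0 \<le> Y (v - 1)" "Y v \<le> Y l"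
      using uv(1,2) by (auto intro!: grid_partition_mono[OF X] grid_partition_mono[OF Y])
    ultimately show "(x, y) \<in> {1..N} \<times> {1..N}"
      using X Y by (auto simp: grid_partition_def)
  qed
  show "\<exists>c d. c \<le> d \<and> (\<forall>x. (x, y) \<in> array_domain k l X Y I \<longleftrightarrow> c \<le> x \<and> x \<le> d)"
    if "y \<in> {1..N}" for y
    using array_domain_row[OF X Y I that] .
  show "\<exists>c d. c \<le> d \<and> (\<forall>y. (x, y) \<in> array_domain k l X Y I \<longleftrightarrow> c \<le> y \<and> y \<le> d)"
    if "x \<in> {1..N}" for x
    using array_domain_row[OF Y X convex_array_transpose[OF I] that]
    unfolding array_domain_transpose[where I = I] .
qed

section \<open>Measures with proportional weights\<close>

lemma prob_space_normalized_measure: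
  assumes "finite A" "A \<noteq> {}" "\<And>x. x \<in> A \<Longrightarrow> w x > 0"
  shows "prob_space (normalized_measure A w)"
proof
  have pos: "sum w A > 0" using assms by (intro sum_pos) auto
  have "emeasure (normalized_measure A w) A = (\<Sum>x\<in>A. ennreal (w x / sum w A))"
    unfolding normalized_measure_def using assms by (intro emeasure_point_measure_finite) auto
  also have "\<dots> = ennreal (\<Sum>x\<in>A. w x / sum w A)"
    using assms(3) pos by (intro sum_ennreal divide_nonneg_nonneg less_imp_le)
  also have "\<dots> = 1"
    using pos by (simp flip: sum_divide_distrib)
  finally show "emeasure (normalized_measure A w) (space (normalized_measure A w)) = 1"
    by (simp add: normalized_measure_def space_point_measure)
qed

text \<open>Normalization cancels the factor of proportionality.\<close>

lemma distr_normalized_measure: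
  assumes fin: "finite A" and bij: "bij_betw f A B" and K: "K \<noteq> 0"
    and w: "\<And>x. x \<in> A \<Longrightarrow> w x = K * w' (f x)"
  shows "distr (normalized_measure A w) (count_space B) f = normalized_measure B w'"
proof (rule measure_eqI)
  show "sets (distr (normalized_measure A w) (count_space B) f) = sets (normalized_measure B w')"
    by (simp add: normalized_measure_def sets_point_measure)
  have finB: "finite B" using fin bij bij_betw_finite by blast
  fix S assume "S \<in> sets (distr (normalized_measure A w) (count_space B) f)"
  then have S: "S \<subseteq> B" by simp
  let ?T = "f -` S \<inter> A"
  have bij_T: "bij_betw f ?T S"
    using bij S by (intro bij_betw_subset[OF bij]) (auto simp: bij_betw_def)
  have "sum w A = (\<Sum>x\<in>A. K * w' (f x))" using w by simp
  also have "\<dots> = K * sum w' B"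
    using sum.reindex_bij_betw[OF bij, of w'] by (simp flip: sum_distrib_left)
  finally have total: "sum w A = K * sum w' B" .
  have "f \<in> measurable (normalized_measure A w) (count_space B)"
    using bij by (auto simp: normalized_measure_def measurable_point_measure_eq1 bij_betw_def)
  then have "emeasure (distr (normalized_measure A w) (count_space B) f) S =
      emeasure (normalized_measure A w) ?T"
    using S by (simp add: emeasure_distr normalized_measure_def space_point_measure)
  also have "\<dots> = (\<Sum>x\<in>?T. ennreal (w x / sum w A))"
    unfolding normalized_measure_def using fin by (intro emeasure_point_measure_finite) auto
  also have "\<dots> = (\<Sum>x\<in>?T. ennreal (w' (f x) / sum w' B))"
    unfolding total using K by (intro sum.cong) (auto simp: w)
  also have "\<dots> = (\<Sum>z\<in>S. ennreal (w' z / sum w' B))"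
    by (rule sum.reindex_bij_betw[OF bij_T])
  also have "\<dots> = emeasure (normalized_measure B w') S"
    unfolding normalized_measure_def using finB S
    by (intro emeasure_point_measure_finite[symmetric]) auto
  finally show "emeasure (distr (normalized_measure A w) (count_space B) f) S =
      emeasure (normalized_measure B w') S" .
qed

section \<open>The correspondence\<close>

theorem theorem2p11:
  fixes N :: int and k l :: nat
    and X Y :: "nat \<Rightarrow> int" and I :: "nat \<Rightarrow> nat \<Rightarrow> nat"
    and a b q :: real and \<Omega> :: "point set"
  assumes "N > 0" and "k > 0" and "l > 0"
    and "grid_partition N k X" and "grid_partition N l Y"
    and "convex_array k l I"
    and "\<Omega> = array_domain k l X Y I"
    and "restricted_perms N \<Omega> \<noteq> {}"
    and "a > 0" and "b > 0" and "q = b\<^sup>2 / a\<^sup>2"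
  shows "\<exists>\<phi>.
     (\<forall>s\<in>degenerate_configs \<Omega>. \<forall>\<sigma>\<in>restricted_perms N \<Omega>.
        \<phi> s = \<sigma> \<longleftrightarrow> vertices_of_type \<Omega> 5 s = perm_points N \<sigma>) \<and>
     bij_betw \<phi> (degenerate_configs \<Omega>) (restricted_perms N \<Omega>) \<and>
     prob_space (normalized_measure (degenerate_configs \<Omega>) (config_weight \<Omega> a b)) \<and>
     prob_space (normalized_measure (restricted_perms N \<Omega>) (\<lambda>\<sigma>. q ^ inversions N \<sigma>)) \<and>
     distr (normalized_measure (degenerate_configs \<Omega>) (config_weight \<Omega> a b))
           (count_space (restricted_perms N \<Omega>)) \<phi>
       = normalized_measure (restricted_perms N \<Omega>) (\<lambda>\<sigma>. q ^ inversions N \<sigma>)"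
proof -
  interpret segmented_domain N \<Omega>
    using segmented_array_domain assms(4-7) by simp
  let ?P = "restricted_perms N \<Omega>" and ?C = "degenerate_configs \<Omega>"
  let ?w = "config_weight \<Omega> a b" and ?w' = "\<lambda>\<sigma>. q ^ inversions N \<sigma>"
  define \<phi> where "\<phi> = inv_into ?P config_of_perm"
  have bij: "bij_betw \<phi> ?C ?P"
    unfolding \<phi>_def by (rule bij_betw_inv_into[OF bij_betw_config_of_perm])
  have \<phi>_in: "\<phi> s \<in> ?P" if "s \<in> ?C" for s
    using bij that by (rule bij_betwE[rule_format])
  have config_\<phi>: "config_of_perm (\<phi> s) = s" if "s \<in> ?C" for s
    unfolding \<phi>_def by (rule bij_betw_inv_into_right[OF bij_betw_config_of_perm that])
  have points: "\<phi> s = \<sigma> \<longleftrightarrow> vertices_of_type \<Omega> 5 s = perm_points N \<sigma>"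
    if "s \<in> ?C" "\<sigma> \<in> ?P" for s \<sigma>
    using type_5_config_of_perm[OF \<phi>_in] config_\<phi> \<phi>_in perm_points_inj that by metis
  have fin_P: "finite ?P"
    by (rule finite_subset[OF _ finite_permutations[of "{1..N}"]])
      (auto simp: restricted_perms_def)
  then have fin_C: "finite ?C" using bij bij_betw_finite by blast
  have "?C \<noteq> {}" using bij assms(8) by (auto simp: bij_betw_def)
  obtain K where K: "K > 0"
    and weight: "\<And>\<sigma>. \<sigma> \<in> ?P \<Longrightarrow> ?w (config_of_perm \<sigma>) = K * ?w' \<sigma>"
    using config_weight_eq[OF assms(8-10)] unfolding assms(11) by blast
  have "?w s = K * ?w' (\<phi> s)" if "s \<in> ?C" for s
    using weight[OF \<phi>_in[OF that]] config_\<phi>[OF that] by simp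
  then have distr: "distr (normalized_measure ?C ?w) (count_space ?P) \<phi> = normalized_measure ?P ?w'"
    using K by (intro distr_normalized_measure[OF fin_C bij, of K]) auto
  have "prob_space (normalized_measure ?C ?w)"
    using fin_C \<open>?C \<noteq> {}\<close> config_weight_positive assms(9,10)
    by (intro prob_space_normalized_measure) auto
  moreover have "prob_space (normalized_measure ?P ?w')"
    using fin_P assms(8-11) by (intro prob_space_normalized_measure) auto
  ultimately show ?thesis
    using points bij distr by blast
qed

end
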